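(* For every integer $k\geq 1$, $$\gamma(P(6k,k))=\begin{cases} \lceil\frac{10k}{3}\rceil, & \text{if } k\neq 2;\\ \lceil\frac{10k}{3}\rceil+1, & \text{if } k=2.\end{cases}$$
   Context: The generalized Petersen graph $P(n,k)$ is the graph on $2n$ vertices with vertex set $\{v_i,u_i: 0\leq i\leq n-1\}$ and edge set $\{v_iv_{i+1},\ v_iu_i,\ u_iu_{i+k}: 0\leq i\leq n-1\}$, subscripts taken modulo $n$. For a graph $G$, a set $S\subseteq V(G)$ is a dominating set if every vertex of $G$ is in $S$ or adjacent to some vertex of $S$; the domination number $\gamma(G)$ is the minimum cardinality of a dominating set of $G$. *)

theory Defs
  imports Complex_Main
begin

text \<open>
  A finite simple graph is given by its vertex set \<open>V\<close> and its edge set \<open>E\<close>, a set of unordered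
  pairs \<open>{x, y}\<close>.
\<close>

definition dominating_set :: "'a set \<Rightarrow> 'a set set \<Rightarrow> 'a set \<Rightarrow> bool" where
  "dominating_set V E S \<longleftrightarrow> S \<subseteq> V \<and> (\<forall>x\<in>V. x \<in> S \<or> (\<exists>y\<in>S. {x, y} \<in> E))"

text \<open>
  Finiteness of \<open>S\<close> excludes infinite sets, which have \<open>card S = 0\<close>; it is automatic when \<open>V\<close> is
  finite, and then \<open>V\<close> itself is a dominating set, so the minimum exists.
\<close>

definition domination_number :: "'a set \<Rightarrow> 'a set set \<Rightarrow> nat" where
  "domination_number V E = (LEAST m. \<exists>S. finite S \<and> dominating_set V E S \<and> card S = m)"

text \<open>\<open>Outer i\<close> is the vertex $v_i$ and \<open>Inner i\<close> is the vertex $u_i$.\<close>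

datatype gp_vertex = Outer nat | Inner nat

definition gp_vertices :: "nat \<Rightarrow> gp_vertex set" where
  "gp_vertices n = Outer ` {0..<n} \<union> Inner ` {0..<n}"

definition gp_edges :: "nat \<Rightarrow> nat \<Rightarrow> gp_vertex set set" where
  "gp_edges n k =
     {{Outer i, Outer ((i + 1) mod n)} | i. i < n} \<union>
     {{Outer i, Inner i} | i. i < n} \<union>
     {{Inner i, Inner ((i + k) mod n)} | i. i < n}"

abbreviation gp_domination_number :: "nat \<Rightarrow> nat \<Rightarrow> nat" where
  "gp_domination_number n k \<equiv> domination_number (gp_vertices n) (gp_edges n k)"

end

theory Submission
  imports Defs
begin

text \<open>
  The inner edges of $P(6k,k)$ form $k$ disjoint 6-cycles. Writing an index as $i + jk$ with
  $i < k$ and $j < 6$ therefore cuts the graph into $k$ columns of twelve vertices: column $i$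
  consists of one inner 6-cycle with its six pendant outer vertices, and an outer vertex in row $j$
  is joined to the outer vertices in row $j$ of the two neighbouring columns. The columns close up
  cyclically with a twist, since column $k$ is column $0$ with its rows rotated by one.
  A set of vertices is dominating iff each column is dominated from inside and from
  the outer members of its two neighbours; this local condition is \<open>dominated_between\<close>.

  For the lower bound let a dominating set have $t$ outer and $s$ inner vertices in a column.
  The inner cycle can only be dominated from its own column, so $t + 3s \ge 6$; the six outer
  vertices give a second inequality, which involves the $t$ of the neighbours. These alone
  allow averages below $10/3$. What is missing is the geometric fact \<open>overlap_bound\<close>: next to a
  column with $s = 1$, a column with $t = 0$ wastes a vertex. With it, a
  discharging argument (\<open>gift\<close>, \<open>balance\<close>) in which columns with $t \ge 2$ support their
  neighbours of weight 2 and 3 shows that the weights average at least $10/3$; this is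
  \<open>lower_bound\<close>. The twist is harmless because only cardinalities enter.

  For the upper bound a dominating set is written as a word of $k$ columns. Three columns of total
  weight 10 can be repeated at will, so one short word for each residue of $k$ modulo 3 is
  enough (\<open>upper_bound_extend\<close>). The short words have 3, 1 and 5 columns and weights 10, 4 and 17,
  which leaves out exactly $k = 2$. There weight 7 would force columns of weights 3 and 4, and
  these leave a vertex undominated (\<open>no_columns_of_weights_3_and_4\<close>).
\<close>

section \<open>Columns\<close>

text \<open>The rows of the outer vertices and the rows of the inner vertices that belong to the set.\<close>

type_synonym column = "nat set \<times> nat set"

definition weight :: "column \<Rightarrow> nat" where
  "weight c = card (fst c) + card (snd c)"

text \<open>
  The first conjunct says that the outer vertices of \<open>c\<close> are dominated when \<open>p\<close> and \<open>n\<close> are the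
  columns before and after it, the second that its inner vertices are; adding 5 modulo 6 steps
  back by one row.
\<close>

definition dominated_between :: "column \<Rightarrow> column \<Rightarrow> column \<Rightarrow> bool" where
  "dominated_between p c n \<longleftrightarrow>
     (\<forall>j<6. (j \<in> fst c \<or> j \<in> snd c \<or> j \<in> fst n \<or> j \<in> fst p) \<and>
            (j \<in> snd c \<or> j \<in> fst c \<or> (j + 1) mod 6 \<in> snd c \<or> (j + 5) mod 6 \<in> snd c))"

text \<open>Moving along the graph by $mk$ indices rotates the rows of a column in this way.\<close>

definition shift :: "nat \<Rightarrow> column \<Rightarrow> column" where
  "shift m c = ({j. j < 6 \<and> (j + m) mod 6 \<in> fst c}, {j. j < 6 \<and> (j + m) mod 6 \<in> snd c})"

lemma dominated_betweenD:
  assumes "dominated_between p c n" "j < 6"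
  shows "j \<in> fst c \<or> j \<in> snd c \<or> j \<in> fst n \<or> j \<in> fst p"
    and "j \<in> snd c \<or> j \<in> fst c \<or> (j + 1) mod 6 \<in> snd c \<or> (j + 5) mod 6 \<in> snd c"
  using assms unfolding dominated_between_def by blast+

lemma less_6_cases:
  fixes j :: nat
  shows "j < 6 \<longleftrightarrow> j = 0 \<or> j = 1 \<or> j = 2 \<or> j = 3 \<or> j = 4 \<or> j = 5"
  by presburger

text \<open>
  Rows may be reduced modulo 6 and indices modulo $6k$ in any order, which makes the twist between
  the last and the first column a matter of arithmetic.
\<close>

lemma row_mod: "(i + (j mod 6) * k) mod (6 * k) = (i + j * k) mod (6 * (k::nat))"
proof -
  have "(j mod 6) * k = (j * k) mod (6 * k)"
    by (simp only: mod_mult_mult2)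
  then show ?thesis
    by (simp only: mod_add_right_eq)
qed

lemma card_by_columns:
  fixes k :: nat
  assumes "k \<ge> 1"
  shows "card {x. x < 6 * k \<and> P x} = (\<Sum>i<k. card {j. j < 6 \<and> P (i + j * k)})"
proof -
  let ?A = "Sigma {..<k} (\<lambda>i. {j. j < 6 \<and> P (i + j * k)})"
  let ?f = "\<lambda>(i, j). i + j * k"
  have unique: "i = i' \<and> j = j'" if "i < k" "i' < k" and eq: "i + j * k = i' + j' * k" for i j i' j'
  proof -
    have "(i + j * k) mod k = i" "(i + j * k) div k = j"
      using that(1) by simp_all
    moreover have "(i + j * k) mod k = i'" "(i + j * k) div k = j'"
      unfolding eq using that(2) by simp_all
    ultimately show ?thesis by simp
  qed
  have inj: "inj_on ?f ?A"
  proof (rule inj_onI)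
    fix u v assume "u \<in> ?A" "v \<in> ?A" "?f u = ?f v"
    then show "u = v"
      using unique[of "fst u" "fst v" "snd u" "snd v"] by (cases u; cases v) simp
  qed
  have "{x. x < 6 * k \<and> P x} = ?f ` ?A"
  proof (intro equalityI subsetI)
    fix x assume x: "x \<in> {x. x < 6 * k \<and> P x}"
    then have "x div k < 6"
      using assms by (simp add: less_mult_imp_div_less)
    moreover have "x mod k + x div k * k = x" by simp
    ultimately have "(x mod k, x div k) \<in> ?A"
      using x assms by auto
    then show "x \<in> ?f ` ?A"
      by (rule rev_image_eqI) simp
  next
    fix x assume "x \<in> ?f ` ?A"
    then obtain i j where ij: "i < k" "j < 6" "P (i + j * k)" "x = i + j * k"
      by auto
    have "j * k \<le> 5 * k" using ij by (intro mult_right_mono) auto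
    with ij(1) have "i + j * k < 6 * k" by linarith
    with ij show "x \<in> {x. x < 6 * k \<and> P x}" by simp
  qed
  then have "card {x. x < 6 * k \<and> P x} = card ?A"
    by (simp add: card_image[OF inj])
  also have "\<dots> = (\<Sum>i<k. card {j. j < 6 \<and> P (i + j * k)})"
    by (rule card_SigmaI) auto
  finally show ?thesis .
qed

lemma card_vertex_set:
  assumes "S \<subseteq> gp_vertices n"
  shows "finite S" "card S = card {x. x < n \<and> Outer x \<in> S} + card {x. x < n \<and> Inner x \<in> S}"
proof -
  have S: "S = Outer ` {x. x < n \<and> Outer x \<in> S} \<union> Inner ` {x. x < n \<and> Inner x \<in> S}"
    using assms unfolding gp_vertices_def by auto
  show "finite S"
    by (rule finite_subset[OF assms]) (simp add: gp_vertices_def)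
  have "card S = card (Outer ` {x. x < n \<and> Outer x \<in> S}) + card (Inner ` {x. x < n \<and> Inner x \<in> S})"
    by (subst S, rule card_Un_disjoint) auto
  then show "card S = card {x. x < n \<and> Outer x \<in> S} + card {x. x < n \<and> Inner x \<in> S}"
    by (simp add: card_image inj_on_def)
qed

text \<open>
  An edge is listed from one of its ends only; this inverts the step to reach the other
  neighbour.
\<close>

lemma plus_mod_eq_iff:
  fixes n d :: nat
  assumes "d \<le> n" "x < n" "y < n"
  shows "x = (y + d) mod n \<longleftrightarrow> y = (x + (n - d)) mod n"
proof
  assume "x = (y + d) mod n"
  then have "(x + (n - d)) mod n = (y + d + (n - d)) mod n"
    by (simp add: mod_add_left_eq)
  then show "y = (x + (n - d)) mod n" using assms by simp
next
  assume "y = (x + (n - d)) mod n"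
  then have "(y + d) mod n = (x + (n - d) + d) mod n"
    by (simp add: mod_add_left_eq)
  then show "x = (y + d) mod n" using assms by simp
qed

lemma dominating_set_iff:
  assumes "0 < k" "k \<le> n"
  shows "dominating_set (gp_vertices n) (gp_edges n k) S \<longleftrightarrow>
    S \<subseteq> gp_vertices n \<and>
    (\<forall>x<n. (Outer x \<in> S \<or> Inner x \<in> S \<or> Outer ((x + 1) mod n) \<in> S \<or> Outer ((x + (n - 1)) mod n) \<in> S) \<and>
           (Inner x \<in> S \<or> Outer x \<in> S \<or> Inner ((x + k) mod n) \<in> S \<or> Inner ((x + (n - k)) mod n) \<in> S))"
    (is "_ \<longleftrightarrow> S \<subseteq> _ \<and> (\<forall>x<n. ?out x \<and> ?inn x)")
proof (cases "S \<subseteq> gp_vertices n")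
  case True
  have n: "0 < n" using assms by simp
  have edges: "{Outer i, Outer ((i + 1) mod n)} \<in> gp_edges n k"
      "{Outer i, Inner i} \<in> gp_edges n k"
      "{Inner i, Inner ((i + k) mod n)} \<in> gp_edges n k" if "i < n" for i
    using that unfolding gp_edges_def by blast+
  have out: "(\<exists>y\<in>S. {Outer x, y} \<in> gp_edges n k) \<longleftrightarrow>
     Inner x \<in> S \<or> Outer ((x + 1) mod n) \<in> S \<or> Outer ((x + (n - 1)) mod n) \<in> S" (is "?l \<longleftrightarrow> ?r")
    if x: "x < n" for x
  proof
    assume ?l
    then obtain y where y: "y \<in> S" "{Outer x, y} \<in> gp_edges n k" by blast
    then have "y = Inner x \<or> (\<exists>z<n. y = Outer z \<and> (z = (x + 1) mod n \<or> x = (z + 1) mod n))"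
      using n unfolding gp_edges_def by (auto simp: doubleton_eq_iff)
    then show ?r
      using y(1) x plus_mod_eq_iff[of 1 n x] n assms by (metis One_nat_def Suc_leI)
  next
    define z where "z = (x + (n - 1)) mod n"
    have "z < n" unfolding z_def using n by simp
    moreover have "x = (z + 1) mod n"
      by (rule iffD2[OF plus_mod_eq_iff]) (use x n assms z_def \<open>z < n\<close> in simp_all)
    ultimately have "{Outer x, Outer z} \<in> gp_edges n k"
      using edges by (metis insert_commute)
    moreover have "{Outer x, Outer ((x + 1) mod n)} \<in> gp_edges n k"
        "{Outer x, Inner x} \<in> gp_edges n k"
      using edges x by simp_all
    moreover assume ?r
    ultimately show ?l unfolding z_def by blast
  qed
  have inn: "(\<exists>y\<in>S. {Inner x, y} \<in> gp_edges n k) \<longleftrightarrow>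
     Outer x \<in> S \<or> Inner ((x + k) mod n) \<in> S \<or> Inner ((x + (n - k)) mod n) \<in> S" (is "?l \<longleftrightarrow> ?r")
    if x: "x < n" for x
  proof
    assume ?l
    then obtain y where y: "y \<in> S" "{Inner x, y} \<in> gp_edges n k" by blast
    then have "y = Outer x \<or> (\<exists>z<n. y = Inner z \<and> (z = (x + k) mod n \<or> x = (z + k) mod n))"
      using n unfolding gp_edges_def by (auto simp: doubleton_eq_iff)
    then show ?r
      using y(1) x plus_mod_eq_iff[of k n x] n assms by (metis One_nat_def Suc_leI)
  next
    define z where "z = (x + (n - k)) mod n"
    have "z < n" unfolding z_def using n by simp
    moreover have "x = (z + k) mod n"
      by (rule iffD2[OF plus_mod_eq_iff]) (use x n assms z_def \<open>z < n\<close> in simp_all)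
    ultimately have "{Inner x, Inner z} \<in> gp_edges n k"
      using edges by (metis insert_commute)
    moreover have "{Inner x, Inner ((x + k) mod n)} \<in> gp_edges n k"
        "{Inner x, Outer x} \<in> gp_edges n k"
      using edges x by (simp_all add: insert_commute)
    moreover assume ?r
    ultimately show ?l unfolding z_def by blast
  qed
  have "(\<forall>v\<in>gp_vertices n. Q v) \<longleftrightarrow> (\<forall>x<n. Q (Outer x) \<and> Q (Inner x))" for Q
    unfolding gp_vertices_def by auto
  then show ?thesis
    unfolding dominating_set_def using True out inn by simp
qed (simp add: dominating_set_def)

text \<open>
  All natural numbers are allowed as column indices: column $i + k$ is column $i$ seen through
  the twist, so that every column has two neighbours without a case distinction.
\<close>

definition column :: "gp_vertex set \<Rightarrow> nat \<Rightarrow> nat \<Rightarrow> column" where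
  "column S k i = ({j. j < 6 \<and> Outer ((i + j * k) mod (6 * k)) \<in> S},
                   {j. j < 6 \<and> Inner ((i + j * k) mod (6 * k)) \<in> S})"

lemma mem_column:
  assumes "j < 6"
  shows "j \<in> fst (column S k i) \<longleftrightarrow> Outer ((i + j * k) mod (6 * k)) \<in> S"
    and "j \<in> snd (column S k i) \<longleftrightarrow> Inner ((i + j * k) mod (6 * k)) \<in> S"
  using assms unfolding column_def by simp_all

lemma column_shift: "column S k (i + m * k) = shift m (column S k i)"
proof -
  have "(i + m * k + j * k) mod (6 * k) = (i + ((j + m) mod 6) * k) mod (6 * k)" for j
    unfolding row_mod by (simp add: algebra_simps)
  then show ?thesis unfolding column_def shift_def by auto
qed

lemma card_rotate:
  fixes T :: "nat set"
  assumes "T \<subseteq> {..<6}"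
  shows "card {j. j < 6 \<and> (j + m) mod 6 \<in> T} = card T"
proof (rule bij_betw_same_card)
  show "bij_betw (\<lambda>j. (j + m) mod 6) {j. j < 6 \<and> (j + m) mod 6 \<in> T} T"
  proof (rule bij_betw_byWitness[where f' = "\<lambda>t. (t + 5 * m) mod 6"])
    have *: "((j + m) mod 6 + 5 * m) mod 6 = j" "((j + 5 * m) mod 6 + m) mod 6 = j" if "j < 6" for j
    proof -
      have "((j + m) mod 6 + 5 * m) mod 6 = (j + 6 * m) mod 6"
          "((j + 5 * m) mod 6 + m) mod 6 = (j + 6 * m) mod 6"
        unfolding mod_add_left_eq by (simp_all add: algebra_simps)
      then show "((j + m) mod 6 + 5 * m) mod 6 = j" "((j + 5 * m) mod 6 + m) mod 6 = j"
        using that by simp_all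
    qed
    show "\<forall>j\<in>{j. j < 6 \<and> (j + m) mod 6 \<in> T}. ((j + m) mod 6 + 5 * m) mod 6 = j"
      using *(1) by simp
    show "\<forall>t\<in>T. ((t + 5 * m) mod 6 + m) mod 6 = t"
      using *(2) assms by auto
    show "(\<lambda>t. (t + 5 * m) mod 6) ` T \<subseteq> {j. j < 6 \<and> (j + m) mod 6 \<in> T}"
      using *(2) assms by auto
  qed auto
qed

lemma column_range: "fst (column S k i) \<subseteq> {..<6}" "snd (column S k i) \<subseteq> {..<6}"
  unfolding column_def by auto

lemma card_column_shift:
  "card (fst (column S k (i + m * k))) = card (fst (column S k i))"
  "card (snd (column S k (i + m * k))) = card (snd (column S k i))"
  unfolding column_shift using column_range[of S k i] by (simp_all add: shift_def card_rotate)

lemma card_columns: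
  assumes "k \<ge> 1" "S \<subseteq> gp_vertices (6 * k)"
  shows "card S = (\<Sum>i<k. weight (column S k i))"
proof -
  have lt: "i + j * k < 6 * k" if "i < k" "j < 6" for i j
  proof -
    have "j * k \<le> 5 * k" using that by (intro mult_right_mono) auto
    with that(1) show ?thesis by linarith
  qed
  have "{j. j < 6 \<and> V (i + j * k) \<in> S} = {j. j < 6 \<and> V ((i + j * k) mod (6 * k)) \<in> S}"
    if "i < k" for i and V :: "nat \<Rightarrow> gp_vertex"
    using lt[OF that] by auto
  then show ?thesis
    unfolding card_vertex_set(2)[OF assms(2)] card_by_columns[OF assms(1)]
    by (simp add: weight_def column_def sum.distrib)
qed

lemma columns_of_dominating_set:
  assumes "k \<ge> 1" "dominating_set (gp_vertices (6 * k)) (gp_edges (6 * k) k) S"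
  shows "dominated_between (column S k i) (column S k (i + 1)) (column S k (i + 2))"
  unfolding dominated_between_def
proof (intro allI impI)
  fix j :: nat assume j: "j < 6"
  let ?n = "6 * k"
  define x where "x = (i + 1 + j * k) mod ?n"
  have x: "x < ?n" using assms unfolding x_def by simp
  have nxt: "(x + 1) mod ?n = (i + 2 + j * k) mod ?n"
    unfolding x_def by (simp add: mod_Suc_eq)
  have "(x + (?n - 1)) mod ?n = (i + 1 + j * k + (?n - 1)) mod ?n"
    unfolding x_def by (simp add: mod_add_left_eq)
  also have "i + 1 + j * k + (?n - 1) = i + j * k + ?n" using assms by simp
  finally have prev: "(x + (?n - 1)) mod ?n = (i + j * k) mod ?n" by simp
  have up: "(x + k) mod ?n = (i + 1 + ((j + 1) mod 6) * k) mod ?n"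
  proof -
    have "(x + k) mod ?n = (i + 1 + j * k + k) mod ?n"
      unfolding x_def by (rule mod_add_left_eq)
    also have "i + 1 + j * k + k = i + 1 + (j + 1) * k" by simp
    finally show ?thesis unfolding row_mod .
  qed
  have down: "(x + (?n - k)) mod ?n = (i + 1 + ((j + 5) mod 6) * k) mod ?n"
  proof -
    have "(x + (?n - k)) mod ?n = (i + 1 + j * k + (?n - k)) mod ?n"
      unfolding x_def by (rule mod_add_left_eq)
    also have "i + 1 + j * k + (?n - k) = i + 1 + (j + 5) * k" by (simp add: algebra_simps)
    finally show ?thesis unfolding row_mod .
  qed
  have "(Outer x \<in> S \<or> Inner x \<in> S \<or> Outer ((x + 1) mod ?n) \<in> S \<or> Outer ((x + (?n - 1)) mod ?n) \<in> S) \<and>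
        (Inner x \<in> S \<or> Outer x \<in> S \<or> Inner ((x + k) mod ?n) \<in> S \<or> Inner ((x + (?n - k)) mod ?n) \<in> S)"
    using assms x dominating_set_iff[of k ?n S] by simp
  then show "(j \<in> fst (column S k (i + 1)) \<or> j \<in> snd (column S k (i + 1)) \<or>
        j \<in> fst (column S k (i + 2)) \<or> j \<in> fst (column S k i)) \<and>
       (j \<in> snd (column S k (i + 1)) \<or> j \<in> fst (column S k (i + 1)) \<or>
        (j + 1) mod 6 \<in> snd (column S k (i + 1)) \<or> (j + 5) mod 6 \<in> snd (column S k (i + 1)))"
    unfolding nxt prev up down unfolding x_def
    by (simp only: mem_column j mod_less_divisor zero_less_numeral simp_thms)
qed

section \<open>The lower bound\<close>

lemma dominated_between_sym: "dominated_between p c n \<longleftrightarrow> dominated_between n c p"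
  unfolding dominated_between_def by blast

lemma finite_column [simp]: "finite (fst (column S k i))" "finite (snd (column S k i))"
  unfolding column_def by simp_all

text \<open>An inner vertex dominates three vertices of its 6-cycle, an outer vertex only one.\<close>

lemma inner_bound:
  assumes "dominated_between p c n" "finite (fst c)" "finite (snd c)"
  shows "6 \<le> card (fst c) + 3 * card (snd c)"
proof -
  let ?U = "snd c" and ?up = "\<lambda>j. (j + 1) mod 6" and ?down = "\<lambda>j::nat. (j + 5) mod 6"
  have "{..<6} \<subseteq> fst c \<union> (?U \<union> (?down ` ?U \<union> ?up ` ?U))"
  proof
    fix j :: nat assume "j \<in> {..<6}"
    then have j: "j < 6" by simp
    have "?up j \<in> ?U \<Longrightarrow> j \<in> ?down ` ?U"
      by (rule image_eqI[where x = "?up j"]) (use j in presburger)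
    moreover have "?down j \<in> ?U \<Longrightarrow> j \<in> ?up ` ?U"
      by (rule image_eqI[where x = "?down j"]) (use j in presburger)
    ultimately show "j \<in> fst c \<union> (?U \<union> (?down ` ?U \<union> ?up ` ?U))"
      using assms(1) j unfolding dominated_between_def by blast
  qed
  then have "6 \<le> card (fst c \<union> (?U \<union> (?down ` ?U \<union> ?up ` ?U)))"
    using card_mono[of "fst c \<union> (?U \<union> (?down ` ?U \<union> ?up ` ?U))" "{..<6}"] assms by simp
  also have "\<dots> \<le> card (fst c) + (card ?U + (card (?down ` ?U) + card (?up ` ?U)))"
    by (meson card_Un_le add_left_mono order_trans)
  also have "\<dots> \<le> card (fst c) + (card ?U + (card ?U + card ?U))"
    using assms by (intro add_mono card_image_le order_refl)
  finally show ?thesis by simp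
qed

lemma outer_bound:
  assumes "dominated_between p c n" "finite (fst p)" "finite (fst c)" "finite (snd c)" "finite (fst n)"
  shows "6 \<le> card (fst p) + card (fst c) + card (fst n) + card (snd c)"
proof -
  have "{..<6} \<subseteq> fst p \<union> fst c \<union> fst n \<union> snd c"
    using assms(1) unfolding dominated_between_def by blast
  then have "6 \<le> card (fst p \<union> fst c \<union> fst n \<union> snd c)"
    using card_mono[of "fst p \<union> fst c \<union> fst n \<union> snd c" "{..<6}"] assms by simp
  also have "\<dots> \<le> card (fst p) + card (fst c) + card (fst n) + card (snd c)"
    by (meson card_Un_le add_right_mono order_trans)
  finally show ?thesis .
qed

text \<open>
  If $y$ is the only inner row used in \<open>p\<close>, then the three rows farthest from $y$ must be outer rows
  of \<open>p\<close>. When \<open>c\<close> has no outer vertices, its inner vertex opposite to $y$ is dominated by an inner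
  vertex of \<open>c\<close> in one of the same three rows, and this row is covered twice. Hence one more than
  six vertices are needed to dominate the outer vertices of \<open>c\<close>.
\<close>

lemma overlap_bound:
  assumes "dominated_between q p c" "dominated_between p c n"
    and "finite (fst p)" "finite (snd c)" "finite (fst n)"
    and "snd p \<subseteq> {..<6}" "card (snd p) = 1" "fst c = {}"
  shows "7 \<le> card (fst p) + card (fst n) + card (snd c)"
proof -
  obtain y where y: "snd p = {y}"
    using assms(7) by (rule card_1_singletonE)
  with assms(6) have "y < 6" by simp
  have far: "x \<in> fst p" if "x < 6" "x \<noteq> y" "(x + 1) mod 6 \<noteq> y" "(x + 5) mod 6 \<noteq> y" for x
    using assms(1) that y unfolding dominated_between_def by auto
  \<comment> \<open>The row opposite to \<open>y\<close> on the 6-cycle.\<close>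
  define z where "z = (y + 3) mod 6"
  have z: "z < 6" unfolding z_def by simp
  have "z \<in> fst p" "(z + 1) mod 6 \<in> fst p" "(z + 5) mod 6 \<in> fst p"
    using \<open>y < 6\<close> unfolding z_def less_6_cases by (auto intro!: far)
  moreover have "z \<in> snd c \<or> (z + 1) mod 6 \<in> snd c \<or> (z + 5) mod 6 \<in> snd c"
    using assms(2) z \<open>fst c = {}\<close> unfolding dominated_between_def by auto
  ultimately have "fst p \<inter> snd c \<noteq> {}" by blast
  then have "card (fst p \<union> snd c) + 1 \<le> card (fst p) + card (snd c)"
    using card_Un_Int[of "fst p" "snd c"] assms card_gt_0_iff[of "fst p \<inter> snd c"] by simp
  moreover have "{..<6} \<subseteq> fst p \<union> snd c \<union> fst n"
    using assms(2,8) unfolding dominated_between_def by blast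
  then have "6 \<le> card (fst p \<union> snd c \<union> fst n)"
    using card_mono[of "fst p \<union> snd c \<union> fst n" "{..<6}"] assms by simp
  then have "6 \<le> card (fst p \<union> snd c) + card (fst n)"
    using card_Un_le order_trans by blast
  ultimately show ?thesis by simp
qed

text \<open>
  What a column with $t$ outer and $s$ inner vertices gives to a neighbour of weight $a$. In units
  where the required average is 10 and each vertex counts 3, weights 2 and 3 lack 4 and 1,
  while weights 4 and 5 have a surplus of 2 and 5. A column with fewer than two
  outer vertices gives nothing, and the surplus 2 is just half of what a neighbour of weight 2
  lacks.
\<close>

definition gift :: "nat \<Rightarrow> nat \<Rightarrow> nat \<Rightarrow> nat" where
  "gift t s a = (if t < 2 then 0
     else if a = 2 then (if t + s \<ge> 5 then 4 else 2)
     else if a = 3 then 1 else 0)"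

text \<open>
  After the gifts every column still has at least 10. The middle column has index 2.
  If $t_2 \le 1$ it gives nothing, and the question is whether it receives enough; this is
  critical for weight 2, where its neighbours must contribute four outer vertices. The two overlap
  hypotheses then exclude a neighbour with three outer vertices and one inner vertex whose
  counterpart on the other side has fewer than two outer vertices. If $t_2 \ge 2$ its weight is at least 4 and it receives nothing, and
  neighbours that ask for a lot have few outer vertices, which forces $s_2$ up.
\<close>

lemma balance:
  fixes s1 s2 s3 t1 t2 t3 :: nat
  assumes "6 \<le> t1 + 3 * s1" "6 \<le> t2 + 3 * s2" "6 \<le> t3 + 3 * s3"
    and "6 \<le> t1 + t2 + t3 + s2"
    and "s1 = 1 \<Longrightarrow> t2 = 0 \<Longrightarrow> 7 \<le> t1 + t3 + s2"
    and "s3 = 1 \<Longrightarrow> t2 = 0 \<Longrightarrow> 7 \<le> t1 + t3 + s2"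
  shows "10 + gift t2 s2 (t1 + s1) + gift t2 s2 (t3 + s3)
       \<le> 3 * (t2 + s2) + gift t1 s1 (t2 + s2) + gift t3 s3 (t2 + s2)"
proof (cases "t2 < 2")
  case True
  have big: "4 \<le> t1 + s1" if "2 \<le> t1" using assms(1) that by linarith
  have big': "4 \<le> t3 + s3" if "2 \<le> t3" using assms(3) that by linarith
  have "2 \<le> t2 + s2" using assms(2) by linarith
  then consider "t2 + s2 = 2" | "t2 + s2 = 3" | "4 \<le> t2 + s2" by linarith
  then have "10 \<le> 3 * (t2 + s2) + gift t1 s1 (t2 + s2) + gift t3 s3 (t2 + s2)"
  proof cases
    case 1
    then have 2: "t2 = 0" "s2 = 2" using assms(2) by linarith+
    then have four: "4 \<le> t1 + t3" using assms(4) by simp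
    \<comment> \<open>Either one neighbour can give 4, or both can give 2.\<close>
    consider "2 \<le> t1" "5 \<le> t1 + s1" | "2 \<le> t3" "5 \<le> t3 + s3" | "2 \<le> t1" "2 \<le> t3"
    proof -
      have "2 \<le> t3" if "2 \<le> t1" "t1 + s1 < 5"
      proof (cases "s1 = 1")
        case True
        then show ?thesis using assms(5) 2 that by simp
      next
        case False
        then have "t1 = 2" using assms(1) that by linarith
        then show ?thesis using four by simp
      qed
      moreover have "2 \<le> t1" if "2 \<le> t3" "t3 + s3 < 5"
      proof (cases "s3 = 1")
        case True
        then show ?thesis using assms(6) 2 that by simp
      next
        case False
        then have "t3 = 2" using assms(3) that by linarith
        then show ?thesis using four by simp
      qed
      ultimately show thesis using that four by linarith
    qed
    then show ?thesis unfolding gift_def using 1 by cases auto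
  next
    case 2
    then have "3 \<le> t1 + t3" using assms(4) by simp
    then have "2 \<le> t1 \<or> 2 \<le> t3" by linarith
    then show ?thesis unfolding gift_def using 2 by auto
  qed simp
  then show ?thesis using True unfolding gift_def by simp
next
  case False
  have small: "t1 = 0" if "t1 + s1 = 2" using assms(1) that by linarith
  have small': "t3 = 0" if "t3 + s3 = 2" using assms(3) that by linarith
  have small1: "t1 \<le> 1" if "t1 + s1 = 3" using assms(1) that by linarith
  have small1': "t3 \<le> 1" if "t3 + s3 = 3" using assms(3) that by linarith
  have "4 \<le> t2 + s2" using assms(2) False by linarith
  then consider "t2 + s2 = 4" | "t2 + s2 = 5" | "6 \<le> t2 + s2" by linarith
  then have "10 + gift t2 s2 (t1 + s1) + gift t2 s2 (t3 + s3) \<le> 3 * (t2 + s2)"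
  proof cases
    case 1
    then have "2 \<le> t1 + t3" using assms(4) by linarith
    then show ?thesis
      unfolding gift_def using 1 False small small' small1 small1' by auto
  next
    case 2
    then have "1 \<le> t1 + t3" using assms(4) by linarith
    then show ?thesis
      unfolding gift_def using 2 False small small' by auto
  next
    case 3
    have "gift t2 s2 a \<le> 4" for a unfolding gift_def by simp
    then have "10 + gift t2 s2 (t1 + s1) + gift t2 s2 (t3 + s3) \<le> 10 + 4 + 4"
      by (intro add_mono order_refl)
    also have "\<dots> \<le> 3 * (t2 + s2)" using 3 by simp
    finally show ?thesis .
  qed
  then show ?thesis by simp
qed

text \<open>
  Once around the cycle, each gift is paid by one column and received by its neighbour, so the
  gifts cancel in the sum of the local inequalities.
\<close>

lemma lower_bound:
  assumes "k \<ge> 1" "dominating_set (gp_vertices (6 * k)) (gp_edges (6 * k) k) S"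
  shows "10 * k \<le> 3 * card S"
proof -
  let ?C = "column S k"
  let ?t = "\<lambda>i. card (fst (?C i))" and ?s = "\<lambda>i. card (snd (?C i))"
  let ?w = "\<lambda>i. weight (?C i)"
  let ?R = "\<lambda>i. gift (?t i) (?s i) (?w (i + 1))"
  let ?L = "\<lambda>i. gift (?t (i + 1)) (?s (i + 1)) (?w i)"
  have dom: "dominated_between (?C i) (?C (i + 1)) (?C (i + 2))" for i
    by (rule columns_of_dominating_set[OF assms])
  have periodic: "?C (i + 6 * k) = ?C i" for i
  proof -
    have "(i + 6 * k + j * k) mod (6 * k) = (i + j * k) mod (6 * k)" for j
      using mod_add_self2[of "i + j * k" "6 * k"] by (simp only: ac_simps)
    then show ?thesis unfolding column_def by simp
  qed
  \<comment> \<open>Going round once avoids a negative index for the column before the first.\<close>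
  have dom': "dominated_between (?C (i + 6 * k - 1)) (?C i) (?C (i + 1))" for i
    using dom[of "i + 6 * k - 1"] periodic[of i] periodic[of "i + 1"] assms(1) by simp
  have inner: "6 \<le> ?t i + 3 * ?s i" for i
    by (rule inner_bound[OF dom']) simp_all
  have outer: "6 \<le> ?t i + ?t (i + 1) + ?t (i + 2) + ?s (i + 1)" for i
    by (rule outer_bound[OF dom]) simp_all
  have left: "7 \<le> ?t i + ?t (i + 2) + ?s (i + 1)" if "?s i = 1" "?t (i + 1) = 0" for i
    by (rule overlap_bound[OF dom' dom]) (use that column_range in simp_all)
  have right: "7 \<le> ?t i + ?t (i + 2) + ?s (i + 1)" if "?s (i + 2) = 1" "?t (i + 1) = 0" for i
  proof -
    have "dominated_between (?C (i + 3)) (?C (i + 2)) (?C (i + 1))"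
      using dom[of "i + 1"] dominated_between_sym by (simp add: numeral_3_eq_3)
    moreover have "dominated_between (?C (i + 2)) (?C (i + 1)) (?C i)"
      using dom dominated_between_sym by blast
    ultimately have "7 \<le> ?t (i + 2) + ?t i + ?s (i + 1)"
      by (rule overlap_bound) (use that column_range in simp_all)
    then show ?thesis by simp
  qed
  have local: "10 + ?L i + ?R (i + 1) \<le> 3 * ?w (i + 1) + ?R i + ?L (i + 1)" for i
    using balance[OF inner[of i] inner[of "i + 1"] inner[of "i + 2"] outer[of i]] left right
    unfolding weight_def by (simp add: add.commute)
  have "10 * m + ?L 0 + ?R m \<le> 3 * (\<Sum>i<m. ?w (i + 1)) + ?R 0 + ?L m" for m
  proof (induction m)
    case (Suc m)
    then show ?case using local[of m] by simp
  qed simp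
  from this[of k] have *: "10 * k + ?L 0 + ?R k \<le> 3 * (\<Sum>i<k. ?w (i + 1)) + ?R 0 + ?L k" .
  have cyclic: "?t (k + i) = ?t i" "?s (k + i) = ?s i" for i
    using card_column_shift[of S k i 1] by (simp_all add: add.commute)
  then have wcyclic: "?w (k + i) = ?w i" for i unfolding weight_def by simp
  have k0: "?t k = ?t 0" "?s k = ?s 0" "?w k = ?w 0"
    using cyclic[of 0] wcyclic[of 0] by simp_all
  have "?L k = ?L 0" "?R k = ?R 0"
    by (simp_all only: k0 cyclic wcyclic add_0)
  moreover have "(\<Sum>i<k. ?w (i + 1)) + ?w 0 = (\<Sum>i<k. ?w i) + ?w k"
    using sum.lessThan_Suc_shift[of ?w k] by simp
  ultimately show ?thesis
    using * k0(3) card_columns[OF assms(1), of S] assms(2)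
    unfolding dominating_set_def by linarith
qed

text \<open>
  For $k = 2$ the two columns \<open>c\<close> and \<open>d\<close> alternate, each time rotated by one row, so \<open>d\<close> lies
  between \<open>c\<close> and \<open>shift 1 c\<close>. If \<open>c\<close> uses the outer row 1, the outer vertices of \<open>d\<close> receive help
  in rows 0 and 1 only, and the four vertices of \<open>d\<close> must occupy the rows 2 to 5, once each.
  Its inner vertices in rows 0 and 1 then force 5 and 2 to be inner rows of \<open>d\<close>, so its outer rows
  are among 3 and 4. This leaves rows 1 and 5 of \<open>shift 1 c\<close> to its own two inner vertices,
  and its inner vertex in row 3 stays undominated.
\<close>

lemma no_columns_of_weights_3_and_4:
  assumes "dominated_between c d (shift 1 c)" "dominated_between d (shift 1 c) (shift 1 d)"
    and "fst c = {1}" "card (snd c) = 2" "snd c \<subseteq> {..<6}"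
    and "weight d = 4" "finite (fst d)" "finite (snd d)"
  shows False
proof -
  have T: "fst (shift 1 c) = {0}"
  proof -
    have "j < 6 \<and> (j + 1) mod 6 = 1 \<longleftrightarrow> j = 0" for j :: nat by presburger
    then show ?thesis by (simp add: shift_def assms(3))
  qed
  have U: "card (snd (shift 1 c)) = 2"
    using card_rotate[OF assms(5), of 1] assms(4) by (simp add: shift_def)
  have "j \<in> fst d \<union> snd d" if "j < 6" "j \<noteq> 0" "j \<noteq> 1" for j
    using dominated_betweenD(1)[OF assms(1) that(1)] that(2,3) T assms(3) by simp
  then have "{2, 3, 4, 5} \<subseteq> fst d \<union> snd d" by simp
  moreover have union: "card (fst d \<union> snd d) + card (fst d \<inter> snd d) = 4"
    using card_Un_Int[OF assms(7,8)] assms(6) unfolding weight_def by simp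
  ultimately have d: "{2, 3, 4, 5} = fst d \<union> snd d"
    using assms(7,8) by (intro card_seteq) auto
  have "card (fst d \<union> snd d) = 4" unfolding d[symmetric] by simp
  then have disjoint: "fst d \<inter> snd d = {}"
    using union assms(7,8) by simp
  have "0 \<notin> fst d \<union> snd d" "1 \<notin> fst d \<union> snd d"
    unfolding d[symmetric] by simp_all
  then have "5 \<in> snd d" "2 \<in> snd d"
    using dominated_betweenD(2)[OF assms(1), of 0] dominated_betweenD(2)[OF assms(1), of 1]
    by (simp_all del: One_nat_def)
  then have "5 \<notin> fst d" "2 \<notin> fst d" using disjoint by blast+
  moreover have "fst d \<subseteq> {2, 3, 4, 5}" unfolding d by blast
  ultimately have d': "fst d \<subseteq> {3, 4}" by auto
  moreover have "j = 2 \<or> j = 3" if "j < 6" "(j + 1) mod 6 = 3 \<or> (j + 1) mod 6 = 4" for j :: nat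
    using that by presburger
  ultimately have "fst (shift 1 d) \<subseteq> {2, 3}"
    unfolding shift_def fst_conv by blast
  then have d'': "1 \<notin> fst (shift 1 d)" "5 \<notin> fst (shift 1 d)" by auto
  have "1 \<notin> fst d" "5 \<notin> fst d" using d' by auto
  then have "1 \<in> snd (shift 1 c)" "5 \<in> snd (shift 1 c)"
    using dominated_betweenD(1)[OF assms(2), of 1] dominated_betweenD(1)[OF assms(2), of 5] T d''
    by (simp_all del: One_nat_def)
  then have "{1, 5} \<subseteq> snd (shift 1 c)" by simp
  then have two: "{1, 5} = snd (shift 1 c)"
    using U by (intro card_seteq) (simp_all add: shift_def)
  have "2 \<notin> snd (shift 1 c)" "3 \<notin> snd (shift 1 c)" "4 \<notin> snd (shift 1 c)"
    unfolding two[symmetric] by simp_all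
  then show False
    using dominated_betweenD(2)[OF assms(2), of 3] T by simp
qed

text \<open>
  The hypotheses are the two covering inequalities for two alternating columns, where both
  neighbours of a column have the same number of outer vertices.
\<close>

lemma weight_7_split:
  fixes s0 s1 t0 t1 :: nat
  assumes "t0 + s0 + (t1 + s1) = 7" "6 \<le> 2 * t0 + t1 + s1" "6 \<le> 2 * t1 + t0 + s0"
    and "6 \<le> t0 + 3 * s0" "6 \<le> t1 + 3 * s1"
  shows "t0 = 1 \<and> s0 = 2 \<and> t1 + s1 = 4 \<or> t1 = 1 \<and> s1 = 2 \<and> t0 + s0 = 4"
proof -
  have "2 \<le> t0 + s0" "2 \<le> t1 + s1" using assms(4,5) by linarith+
  then consider "t0 + s0 = 2" | "t0 + s0 = 3" | "t1 + s1 = 3" | "t1 + s1 = 2"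
    using assms(1) by linarith
  then show ?thesis using assms by cases linarith+
qed

lemma lower_bound_exceptional:
  assumes "dominating_set (gp_vertices 12) (gp_edges 12 2) S"
  shows "8 \<le> card S"
proof (rule ccontr)
  let ?C = "column S 2"
  let ?t = "\<lambda>i. card (fst (?C i))" and ?s = "\<lambda>i. card (snd (?C i))"
  assume "\<not> 8 \<le> card S"
  then have "card S = 7" using lower_bound[of 2 S] assms by simp
  then have seven: "?t 0 + ?s 0 + (?t 1 + ?s 1) = 7"
    using card_columns[of 2 S] assms unfolding dominating_set_def
    by (simp add: weight_def numeral_2_eq_2)
  have dom: "dominated_between (?C i) (?C (i + 1)) (?C (i + 2))" for i
    using columns_of_dominating_set[of 2 S i] assms by simp
  have step: "?C (i + 2) = shift 1 (?C i)" for i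
    using column_shift[of S 2 i 1] by simp
  have card_step: "?t (i + 2) = ?t i" "?s (i + 2) = ?s i" for i
    using card_column_shift[of S 2 i 1] by simp_all
  have False if i: "?t i = 1" "?s i = 2" "?t (i + 1) + ?s (i + 1) = 4" for i
  proof -
    obtain p where p: "fst (?C i) = {p}" using i(1) by (rule card_1_singletonE)
    then have "p < 6" using column_range(1)[of S 2 i] by simp
    \<comment> \<open>Rotating by \<open>m\<close> rows moves the outer row \<open>p\<close> to row 1.\<close>
    define m where "m = (p + 5) mod 6"
    define l where "l = i + m * 2"
    have "j < 6 \<and> (j + m) mod 6 = p \<longleftrightarrow> j = 1" for j
    proof -
      consider "p = 0" "m = 5" | "p = 1" "m = 0" | "p = 2" "m = 1" | "p = 3" "m = 2"
        | "p = 4" "m = 3" | "p = 5" "m = 4"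
        using \<open>p < 6\<close> unfolding m_def less_6_cases by fastforce
      then show ?thesis by cases (simp_all, presburger+)
    qed
    then have "fst (?C l) = {1}"
      unfolding l_def column_shift using p by (simp add: shift_def)
    moreover have "?s l = 2" "?t (l + 1) + ?s (l + 1) = 4"
      using card_column_shift[of S 2 i m] card_column_shift[of S 2 "i + 1" m] i
      unfolding l_def by (simp_all add: add.commute add.left_commute)
    moreover have "dominated_between (?C l) (?C (l + 1)) (shift 1 (?C l))"
      using dom[of l] step[of l] by simp
    moreover have "dominated_between (?C (l + 1)) (shift 1 (?C l)) (shift 1 (?C (l + 1)))"
      using dom[of "l + 1"] step[of l] step[of "l + 1"] by (simp add: numeral_eq_Suc)
    ultimately show False
      using column_range[of S 2 l]
      by (intro no_columns_of_weights_3_and_4[of "?C l" "?C (l + 1)"]) (simp_all add: weight_def)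
  qed
  from this[of 0] this[of 1] card_step[of 0]
  have neither: "\<not> (?t 0 = 1 \<and> ?s 0 = 2 \<and> ?t 1 + ?s 1 = 4)" "\<not> (?t 1 = 1 \<and> ?s 1 = 2 \<and> ?t 0 + ?s 0 = 4)"
    by (auto simp: numeral_2_eq_2)
  have "6 \<le> ?t 0 + ?t 1 + ?t 2 + ?s 1" "6 \<le> ?t 1 + ?t 2 + ?t 3 + ?s 2"
    using outer_bound[OF dom[of 0]] outer_bound[OF dom[of 1]] by (simp_all add: numeral_eq_Suc)
  moreover have "?t 2 = ?t 0" "?s 2 = ?s 0" "?t 3 = ?t 1"
    using card_step[of 0] card_step[of 1] by (simp_all add: numeral_eq_Suc)
  moreover have "6 \<le> ?t 1 + 3 * ?s 1" "6 \<le> ?t 2 + 3 * ?s 2"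
    using inner_bound[OF dom[of 0]] inner_bound[OF dom[of 1]] by (simp_all add: numeral_eq_Suc)
  ultimately have "?t 0 = 1 \<and> ?s 0 = 2 \<and> ?t 1 + ?s 1 = 4 \<or> ?t 1 = 1 \<and> ?s 1 = 2 \<and> ?t 0 + ?s 0 = 4"
    by (intro weight_7_split[OF seven]) simp_all
  then show False using neither by blast
qed

section \<open>The upper bound\<close>

text \<open>
  The first and the last column of a chain are only context; the columns in between have to be
  dominated.
\<close>

fun chain :: "column list \<Rightarrow> bool" where
  "chain (p # c # n # cs) \<longleftrightarrow> dominated_between p c n \<and> chain (c # n # cs)"
| "chain _ \<longleftrightarrow> True"

text \<open>
  The column before the first is the last one rotated back by one row (that is, forward by five),
  and the column after the last is the first one rotated forward.
\<close>

definition closed_word :: "column list \<Rightarrow> bool" where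
  "closed_word ws \<longleftrightarrow> chain (shift 5 (last ws) # ws @ [shift 1 (hd ws)])"

lemma chain_nth:
  assumes "chain cs" "i + 2 < length cs"
  shows "dominated_between (cs ! i) (cs ! (i + 1)) (cs ! (i + 2))"
  using assms
proof (induction cs arbitrary: i rule: chain.induct)
  case (1 p c n cs)
  then show ?case by (cases i) auto
qed auto

lemma closed_word_upper_bound:
  assumes "closed_word ws" "length ws = k" "k \<ge> 1"
    and range: "\<And>c. c \<in> set ws \<Longrightarrow> fst c \<subseteq> {..<6} \<and> snd c \<subseteq> {..<6}"
  shows "gp_domination_number (6 * k) k \<le> sum_list (map weight ws)"
proof -
  let ?n = "6 * k"
  define S where "S = Outer ` {x. x < ?n \<and> x div k \<in> fst (ws ! (x mod k))} \<union>
                      Inner ` {x. x < ?n \<and> x div k \<in> snd (ws ! (x mod k))}"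
  have SV: "S \<subseteq> gp_vertices ?n" unfolding S_def gp_vertices_def by auto
  have mem: "Outer ((i + j * k) mod ?n) \<in> S \<longleftrightarrow> j mod 6 \<in> fst (ws ! i)"
      "Inner ((i + j * k) mod ?n) \<in> S \<longleftrightarrow> j mod 6 \<in> snd (ws ! i)" if "i < k" for i j
  proof -
    have "(j mod 6) * k \<le> 5 * k" by (intro mult_right_mono) auto
    then have "i + (j mod 6) * k < ?n" using that by linarith
    then have eq: "(i + j * k) mod ?n = i + (j mod 6) * k"
      using row_mod[of i j k] by simp
    moreover have "(i + (j mod 6) * k) div k = j mod 6" "(i + (j mod 6) * k) mod k = i"
      using that by simp_all
    ultimately show "Outer ((i + j * k) mod ?n) \<in> S \<longleftrightarrow> j mod 6 \<in> fst (ws ! i)"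
      "Inner ((i + j * k) mod ?n) \<in> S \<longleftrightarrow> j mod 6 \<in> snd (ws ! i)"
      using \<open>i + (j mod 6) * k < ?n\<close> unfolding eq S_def by auto
  qed
  have "column S k i = ws ! i" if "i < k" for i
  proof -
    have "fst (ws ! i) \<subseteq> {..<6}" "snd (ws ! i) \<subseteq> {..<6}"
      using range[of "ws ! i"] that assms(2) by auto
    then show ?thesis
      unfolding column_def mem[OF that] by (auto intro!: prod_eqI)
  qed
  then have "card S = (\<Sum>i<k. weight (ws ! i))"
    unfolding card_columns[OF assms(3) SV] by simp
  also have "\<dots> = sum_list (map weight ws)"
    using assms(2) by (simp add: sum_list_sum_nth atLeast0LessThan)
  finally have card: "card S = sum_list (map weight ws)" .
  \<comment> \<open>Column \<open>i\<close> of the word is entry \<open>i + 1\<close> of the chain.\<close>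
  define cs where "cs = shift 5 (last ws) # ws @ [shift 1 (hd ws)]"
  have "ws \<noteq> []" using assms(2,3) by auto
  have cs: "cs ! (i + 1) = ws ! i"
      "cs ! (i + 2) = (if i + 1 < k then ws ! (i + 1) else shift 1 (ws ! 0))"
      "cs ! i = (if i = 0 then shift 5 (ws ! (k - 1)) else ws ! (i - 1))" if "i < k" for i
    using that assms(2) \<open>ws \<noteq> []\<close> unfolding cs_def
    by (auto simp: nth_append last_conv_nth hd_conv_nth nth_Cons split: nat.split)
  have dom: "dominated_between (cs ! i) (cs ! (i + 1)) (cs ! (i + 2))" if "i < k" for i
    using assms(1,2) that unfolding closed_word_def cs_def by (intro chain_nth) simp_all
  have "dominating_set (gp_vertices ?n) (gp_edges ?n k) S"
  proof (rule iffD2[OF dominating_set_iff])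
    show "S \<subseteq> gp_vertices ?n \<and> (\<forall>x<?n.
      (Outer x \<in> S \<or> Inner x \<in> S \<or> Outer ((x + 1) mod ?n) \<in> S \<or> Outer ((x + (?n - 1)) mod ?n) \<in> S) \<and>
      (Inner x \<in> S \<or> Outer x \<in> S \<or> Inner ((x + k) mod ?n) \<in> S \<or> Inner ((x + (?n - k)) mod ?n) \<in> S))"
    proof (intro conjI allI impI)
      show "S \<subseteq> gp_vertices ?n" by (rule SV)
    next
      fix x assume x: "x < ?n"
      define i j where "i = x mod k" and "j = x div k"
      have i: "i < k" unfolding i_def using assms(3) by simp
      have j: "j < 6" unfolding j_def using x by (simp add: less_mult_imp_div_less)
      have xij: "x = i + j * k" unfolding i_def j_def by simp
      have "Outer ((i + j * k) mod ?n) \<in> S \<longleftrightarrow> j \<in> fst (ws ! i)"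
          "Inner ((i + j * k) mod ?n) \<in> S \<longleftrightarrow> j \<in> snd (ws ! i)"
        using mem[OF i, of j] j by simp_all
      then have self: "Outer x \<in> S \<longleftrightarrow> j \<in> fst (ws ! i)" "Inner x \<in> S \<longleftrightarrow> j \<in> snd (ws ! i)"
        using x unfolding xij[symmetric] by simp_all
      have succ: "Outer ((x + 1) mod ?n) \<in> S" if "j \<in> fst (cs ! (i + 2))"
      proof (cases "i + 1 < k")
        case True
        then show ?thesis
          using mem(1)[OF True, of j] that j cs(2)[OF i] xij by simp
      next
        case False
        then have "x + 1 = 0 + (j + 1) * k" using xij i by simp
        moreover have "(j + 1) mod 6 \<in> fst (ws ! 0)"
          using that cs(2)[OF i] False by (simp add: shift_def)
        ultimately show ?thesis
          using mem(1)[of 0 "j + 1"] assms(3) by simp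
      qed
      have pred: "Outer ((x + (?n - 1)) mod ?n) \<in> S" if "j \<in> fst (cs ! i)"
      proof (cases "i = 0")
        case True
        then have "x + (?n - 1) = (k - 1) + (j + 5) * k"
          using xij assms(3) by (simp add: algebra_simps)
        moreover have "(j + 5) mod 6 \<in> fst (ws ! (k - 1))"
          using that cs(3)[OF i] True by (simp add: shift_def)
        ultimately show ?thesis
          using mem(1)[of "k - 1" "j + 5"] assms(3) by simp
      next
        case False
        then have "x + (?n - 1) = (i - 1) + j * k + ?n"
          using xij assms(3) by simp
        then have "(x + (?n - 1)) mod ?n = ((i - 1) + j * k) mod ?n" by simp
        then show ?thesis
          using mem(1)[of "i - 1" j] that cs(3)[OF i] False i j by simp
      qed
      have "x + k = i + (j + 1) * k" "x + (?n - k) = i + (j + 5) * k"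
        using xij by (simp_all add: algebra_simps)
      then have inner: "Inner ((x + k) mod ?n) \<in> S \<longleftrightarrow> (j + 1) mod 6 \<in> snd (ws ! i)"
          "Inner ((x + (?n - k)) mod ?n) \<in> S \<longleftrightarrow> (j + 5) mod 6 \<in> snd (ws ! i)"
        using mem(2)[OF i] by (simp_all only:)
      show "Outer x \<in> S \<or> Inner x \<in> S \<or> Outer ((x + 1) mod ?n) \<in> S \<or> Outer ((x + (?n - 1)) mod ?n) \<in> S"
        using dominated_betweenD(1)[OF dom[OF i] j] self succ pred unfolding cs(1)[OF i] by blast
      show "Inner x \<in> S \<or> Outer x \<in> S \<or> Inner ((x + k) mod ?n) \<in> S \<or> Inner ((x + (?n - k)) mod ?n) \<in> S"
        using dominated_betweenD(2)[OF dom[OF i] j] self inner unfolding cs(1)[OF i] by blast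
    qed
  qed (use assms(3) in simp_all)
  then show ?thesis
    unfolding domination_number_def card[symmetric]
    using card_vertex_set(1)[OF SV] by (intro Least_le) blast
qed

text \<open>The condition only looks at three consecutive columns, so chains can be glued along two.\<close>

lemma chain_append_overlap:
  assumes "chain (xs @ [b, c])" "chain (b # c # ys)"
  shows "chain (xs @ b # c # ys)"
  using assms
proof (induction xs rule: chain.induct)
  case (1 p c n cs)
  then show ?case by (cases cs) auto
next
  case ("2_3" v vb)
  then show ?case by simp
qed auto

text \<open>
  The three conditions on chains cover every place where the block \<open>a\<close>, \<open>b\<close>, \<open>c\<close> meets the
  word, another copy of itself, or the twisted beginning of the word.
\<close>

lemma closed_word_extend:
  assumes "closed_word ws" "ws \<noteq> []"
    and first: "chain (shift 5 c # ws @ [a, b, c])"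
    and block: "chain [b, c, a, b, c]"
    and last: "chain [b, c, shift 1 (hd ws)]"
  shows "closed_word (ws @ concat (replicate m [a, b, c]))"
proof (cases m)
  case 0
  then show ?thesis using assms(1) by simp
next
  case (Suc l)
  have "chain (b # c # concat (replicate l [a, b, c]) @ [shift 1 (hd ws)])"
  proof (induction l)
    case (Suc l)
    then show ?case using block by simp
  qed (use last in simp)
  then have "chain ((shift 5 c # ws @ [a]) @ b # c # concat (replicate l [a, b, c]) @ [shift 1 (hd ws)])"
    by (rule chain_append_overlap[rotated]) (use first in simp)
  moreover have "last (ws @ concat (replicate m [a, b, c])) = c"
  proof -
    have "concat (replicate (Suc l) [a, b, c]) = concat (replicate l [a, b, c]) @ [a, b, c]"
      by (induction l) simp_all
    then show ?thesis unfolding Suc by simp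
  qed
  ultimately show ?thesis
    unfolding closed_word_def using Suc assms(2) by simp
qed

lemma all_less_6: "(\<forall>j<6. P j) \<longleftrightarrow> P 0 \<and> P 1 \<and> P 2 \<and> P 3 \<and> P 4 \<and> P (5::nat)"
  by (simp add: numeral_eq_Suc All_less_Suc conj_ac)

lemma upper_bound_extend:
  assumes "closed_word ws" "ws \<noteq> []"
    and "chain (shift 5 c # ws @ [a, b, c])" "chain [b, c, a, b, c]" "chain [b, c, shift 1 (hd ws)]"
    and range: "\<And>d. d \<in> set (ws @ [a, b, c]) \<Longrightarrow> fst d \<subseteq> {..<6} \<and> snd d \<subseteq> {..<6}"
    and "weight a + weight b + weight c = 10" "k = length ws + 3 * m"
  shows "gp_domination_number (6 * k) k \<le> sum_list (map weight ws) + 10 * m"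
proof -
  let ?ws = "ws @ concat (replicate m [a, b, c])"
  have "gp_domination_number (6 * k) k \<le> sum_list (map weight ?ws)"
  proof (rule closed_word_upper_bound)
    show "closed_word ?ws" using assms(1-5) by (rule closed_word_extend)
    show "length ?ws = k" using assms(8) by (simp add: length_concat sum_list_replicate)
    show "k \<ge> 1" using assms(2,8) by (cases ws) auto
    have "set ?ws \<subseteq> set (ws @ [a, b, c])" by (auto split: if_splits)
    then show "fst d \<subseteq> {..<6} \<and> snd d \<subseteq> {..<6}" if "d \<in> set ?ws" for d
      using range that by blast
  qed
  also have "sum_list (map weight (concat (replicate m [a, b, c]))) = 10 * m"
    using assms(7) by (induction m) simp_all
  then have "sum_list (map weight ?ws) = sum_list (map weight ws) + 10 * m" by simp
  finally show ?thesis .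
qed

lemmas word_simps = closed_word_def dominated_between_def shift_def all_less_6 weight_def

text \<open>
  The middle column has outer vertices in the rows 0, 1, 3, 4 and inner ones in the
  remaining rows 2 and 5. The outer vertices serve both sides, so that three consecutive columns
  dominate themselves and the twist does not matter.
\<close>

lemma upper_bound_mod_0:
  "gp_domination_number (6 * (3 + 3 * m)) (3 + 3 * m) \<le> 10 + 10 * m"
proof -
  let ?a = "({}, {2, 5}) :: column" and ?b = "({0, 1, 3, 4}, {2, 5}) :: column"
  have "gp_domination_number (6 * (3 + 3 * m)) (3 + 3 * m) \<le> sum_list (map weight [?a, ?b, ?a]) + 10 * m"
    by (rule upper_bound_extend[where a = ?a and b = ?b and c = ?a]) (auto simp: word_simps)
  then show ?thesis by (simp add: weight_def)
qed

text \<open>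
  All columns are invariant under rotation by three rows: the set is the preimage of a dominating
  set of $P(3k,k)$ under the double covering by $P(6k,k)$. For $m = 0$ the word is a single
  column that is, up to rotation, its own neighbour on both sides.
\<close>

lemma upper_bound_mod_1:
  "gp_domination_number (6 * (1 + 3 * m)) (1 + 3 * m) \<le> 4 + 10 * m"
proof -
  let ?w = "({1, 4}, {0, 3}) :: column"
  let ?a = "({}, {2, 5}) :: column" and ?b = "({0, 3}, {2, 5}) :: column" and ?c = "({1, 4}, {2, 5}) :: column"
  have "gp_domination_number (6 * (1 + 3 * m)) (1 + 3 * m) \<le> sum_list (map weight [?w]) + 10 * m"
    by (rule upper_bound_extend[where a = ?a and b = ?b and c = ?c]) (auto simp: word_simps)
  then show ?thesis by (simp add: weight_def)
qed

text \<open>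
  Sets that are invariant under rotation by three rows have an even number of elements, so the
  odd bound $17 + 10m$ needs a less symmetric word. Its numbers of outer vertices are
  2, 1, 1, 2, 1, continued by 2, 1, 1; columns with one outer vertex have weight 3 and those with
  two have weight 4.
\<close>

lemma upper_bound_mod_2:
  "gp_domination_number (6 * (5 + 3 * m)) (5 + 3 * m) \<le> 17 + 10 * m"
proof -
  let ?ws = "[({0, 3}, {2, 4}), ({5}, {1, 4}), ({2}, {0, 3}), ({1, 4}, {3, 5}), ({0}, {0, 3})] :: column list"
  let ?a = "({2, 5}, {1, 4}) :: column" and ?b = "({3}, {1, 4}) :: column" and ?c = "({0}, {1, 4}) :: column"
  have "gp_domination_number (6 * (5 + 3 * m)) (5 + 3 * m) \<le> sum_list (map weight ?ws) + 10 * m"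
    by (rule upper_bound_extend[where a = ?a and b = ?b and c = ?c]) (auto simp: word_simps)
  then show ?thesis by (simp add: weight_def)
qed

lemma upper_bound_exceptional: "gp_domination_number 12 2 \<le> 8"
proof -
  let ?ws = "[({}, {2, 5}), ({0, 3}, {1, 2, 4, 5})] :: column list"
  have "gp_domination_number (6 * 2) 2 \<le> sum_list (map weight ?ws)"
    by (rule closed_word_upper_bound) (auto simp: word_simps)
  then show ?thesis by (simp add: weight_def)
qed

section \<open>The domination number\<close>

lemma domination_number_attained:
  "\<exists>S. dominating_set (gp_vertices n) (gp_edges n k) S \<and> card S = gp_domination_number n k"
proof -
  have "finite (gp_vertices n)" "dominating_set (gp_vertices n) (gp_edges n k) (gp_vertices n)"
    unfolding dominating_set_def by (simp_all add: gp_vertices_def)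
  then have "\<exists>m S. finite S \<and> dominating_set (gp_vertices n) (gp_edges n k) S \<and> card S = m"
    by blast
  then show ?thesis unfolding domination_number_def by (rule LeastI2_ex) blast
qed

theorem corollary4p6:
  fixes k :: nat
  assumes "k \<ge> 1"
  shows "int (gp_domination_number (6 * k) k) =
    (if k \<noteq> 2 then \<lceil>10 * real k / 3\<rceil> else \<lceil>10 * real k / 3\<rceil> + 1)"
proof -
  let ?g = "gp_domination_number (6 * k) k"
  obtain S where S: "dominating_set (gp_vertices (6 * k)) (gp_edges (6 * k) k) S" "card S = ?g"
    using domination_number_attained by blast
  then have low: "10 * k \<le> 3 * ?g" using lower_bound[OF assms S(1)] by simp
  show ?thesis
  proof (cases "k = 2")
    case True
    then have "?g = 8" using S lower_bound_exceptional[of S] upper_bound_exceptional by simp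
    moreover have "\<lceil>10 * real k / 3\<rceil> = 7" using True by (intro ceiling_unique) simp_all
    ultimately show ?thesis using True by simp
  next
    case False
    have "k = 3 + 3 * (k div 3 - 1) \<or> k = 1 + 3 * (k div 3) \<or> k = 5 + 3 * (k div 3 - 1)"
      using assms False by presburger
    then obtain m where "k = 3 + 3 * m \<or> k = 1 + 3 * m \<or> k = 5 + 3 * m" by blast
    then have "3 * ?g \<le> 10 * k + 2"
      using upper_bound_mod_0[of m] upper_bound_mod_1[of m] upper_bound_mod_2[of m] by (elim disjE) simp_all
    with low have "real (10 * k) \<le> real (3 * ?g)" "real (3 * ?g) \<le> real (10 * k + 2)"
      by (simp_all only: of_nat_le_iff)
    then have "\<lceil>10 * real k / 3\<rceil> = int ?g"
      by (intro ceiling_unique) simp_all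
    then show ?thesis using False by simp
  qed
qed

end
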